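(* Let $m\ge2$. There is a constant $C_m>0$ depending only on $m$ such that for every integer $N\ge2$ coprime to $m$, $$\tfrac13\operatorname{ord}_m(N)\le \operatorname{diam}\mathrm{Cay}\big(G_m/G_m(N),\{A,T\}\big)\le C_m\operatorname{ord}_m(N).$$ (One may take $C_m=2m(2+\log m)$.)
   Context: $G_m$ is the subgroup of $GL_2(\mathbb Z[1/m])$ of matrices $\begin{pmatrix} m^k & r\\ 0&1\end{pmatrix}$, $k\in\mathbb Z$, $r\in\mathbb Z[1/m]$, generated by $A=\begin{pmatrix}1&1\\0&1\end{pmatrix}$ and $T=\begin{pmatrix}m&0\\0&1\end{pmatrix}$. For $N$ coprime to $m$, $G_m(N)$ is the kernel of reduction modulo $N$, $G_m\to GL_2(\mathbb Z/N\mathbb Z)$, and $\operatorname{ord}_m(N)$ is the multiplicative order of $m$ modulo $N$. The Cayley graph is taken with respect to the images of $A^{\pm1},T^{\pm1}$. *)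

theory Defs
  imports "HOL-Analysis.Finite_Cartesian_Product" "HOL-Analysis.Cartesian_Space"
    "HOL-Algebra.Coset" "HOL-Number_Theory.Pocklington"
begin

text \<open>2x2 rational matrices; the generators A, T of G_m and their inverses.\<close>

definition mat2 :: "rat \<Rightarrow> rat \<Rightarrow> rat \<Rightarrow> rat \<Rightarrow> rat^2^2" where
  "mat2 a b c d = vector [vector [a, b], vector [c, d]]"

definition Amat :: "rat^2^2" where "Amat = mat2 1 1 0 1"
definition Ainv :: "rat^2^2" where "Ainv = mat2 1 (-1) 0 1"
definition Tmat :: "nat \<Rightarrow> rat^2^2" where "Tmat m = mat2 (of_nat m) 0 0 1"
definition Tinv :: "nat \<Rightarrow> rat^2^2" where "Tinv m = mat2 (1 / of_nat m) 0 0 1"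

definition gens :: "nat \<Rightarrow> (rat^2^2) set" where
  "gens m = {Amat, Ainv, Tmat m, Tinv m}"

text \<open>G_m: the subgroup of GL_2(Q) generated by A and T (all finite products of
  A^{+-1}, T^{+-1}).\<close>
definition Gm_carrier :: "nat \<Rightarrow> (rat^2^2) set" where
  "Gm_carrier m = {foldr (**) ws (mat 1) | ws. set ws \<subseteq> gens m}"

definition Gm :: "nat \<Rightarrow> (rat^2^2) monoid" where
  "Gm m = \<lparr>carrier = Gm_carrier m, monoid.mult = (**), one = mat 1\<rparr>"

text \<open>Congruence modulo N in Z[1/m]: q - c lies in N * Z[1/m].  For N coprime to m,
  Z[1/m]/N Z[1/m] = Z/NZ, so this is equality after reduction modulo N.\<close>
definition congN :: "nat \<Rightarrow> nat \<Rightarrow> rat \<Rightarrow> rat \<Rightarrow> bool" where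
  "congN m N q c \<longleftrightarrow> (\<exists>(a::int) (j::nat). q - c = of_nat N * of_int a / of_nat m ^ j)"

text \<open>G_m(N): kernel of reduction modulo N, G_m -> GL_2(Z/NZ).\<close>
definition GmN :: "nat \<Rightarrow> nat \<Rightarrow> (rat^2^2) set" where
  "GmN m N = {g \<in> Gm_carrier m. \<forall>i j. congN m N (g $ i $ j) (mat 1 $ i $ j)}"

text \<open>Word metric of the Cayley graph of a group G with respect to a generating set S
  (edges x -- x s, s in S; S is symmetric below), and its diameter.\<close>
definition cay_dist :: "('a, 'b) monoid_scheme \<Rightarrow> 'a set \<Rightarrow> 'a \<Rightarrow> 'a \<Rightarrow> nat" where
  "cay_dist G S x y = (LEAST n. \<exists>ws. length ws = n \<and> set ws \<subseteq> S \<and>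
       x \<otimes>\<^bsub>G\<^esub> foldr (\<lambda>s acc. s \<otimes>\<^bsub>G\<^esub> acc) ws \<one>\<^bsub>G\<^esub> = y)"

definition cay_diam :: "('a, 'b) monoid_scheme \<Rightarrow> 'a set \<Rightarrow> nat" where
  "cay_diam G S = Sup {cay_dist G S x y | x y. x \<in> carrier G \<and> y \<in> carrier G}"

text \<open>The quotient G_m/G_m(N) with the images of A^{+-1}, T^{+-1} as generators.\<close>
definition Qgrp :: "nat \<Rightarrow> nat \<Rightarrow> (rat^2^2) set monoid" where
  "Qgrp m N = Gm m Mod GmN m N"

definition Qgens :: "nat \<Rightarrow> nat \<Rightarrow> (rat^2^2) set set" where
  "Qgens m N = {GmN m N #>\<^bsub>Gm m\<^esub> g | g. g \<in> gens m}"

end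

theory Submission
  imports Defs
begin

text \<open>Every element of \<open>G_m\<close> is an affine matrix \<open>[[m^i / m^j, b], [0, 1]]\<close> with \<open>b \<in> \<int>[1/m]\<close>,
  and a word of length \<open>n\<close> in the generators yields one with \<open>i + j \<le> n\<close>. Modulo \<open>G_m(N)\<close>
  the matrix only matters through \<open>m^(i-j) mod N\<close>, a power of \<open>m\<close> of order \<open>d = ord_m(N)\<close>, and
  through \<open>b mod N\<close>, which is represented by an integer \<open>r < N \<le> m^d\<close>. Expanding \<open>r\<close> in
  base \<open>m\<close> writes \<open>A^r\<close> as a word of length at most \<open>(m + 1) d\<close>, and \<open>A^r T^k\<close> with \<open>k < d\<close>
  reaches every coset: the diameter is at most \<open>(m + 2) d\<close>. Conversely, a word of length
  \<open>n < d/2\<close> reaching the coset of \<open>T^(d/2)\<close> would give \<open>m^i \<equiv> m^(j + d/2) mod N\<close> with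
  \<open>0 < j + d/2 - i < d\<close>, contradicting the minimality of \<open>d\<close>; for \<open>d = 1\<close> the coset of \<open>A\<close>
  is at distance 1 from the identity.\<close>

section \<open>Cayley graphs of quotient groups\<close>

lemma (in monoid) foldr_mult_closed: "set gs \<subseteq> carrier G \<Longrightarrow> foldr (\<otimes>) gs \<one> \<in> carrier G"
  by (induction gs) auto

context normal
begin

lemma rcos_mult_eq_iff:
  assumes "x \<in> carrier G" "w \<in> carrier G" "y \<in> carrier G"
  shows "H #> (x \<otimes> w) = H #> y \<longleftrightarrow> H #> w = H #> (inv x \<otimes> y)"
proof
  assume "H #> (x \<otimes> w) = H #> y"
  then have "(H #> inv x) <#> (H #> (x \<otimes> w)) = (H #> inv x) <#> (H #> y)" by simp
  then show "H #> w = H #> (inv x \<otimes> y)"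
    using assms by (simp add: rcos_sum m_assoc[symmetric])
next
  assume "H #> w = H #> (inv x \<otimes> y)"
  then have "(H #> x) <#> (H #> w) = (H #> x) <#> (H #> (inv x \<otimes> y))" by simp
  then show "H #> (x \<otimes> w) = H #> y"
    using assms by (simp add: rcos_sum m_assoc[symmetric])
qed

lemma FactGroup_foldr:
  "set gs \<subseteq> carrier G \<Longrightarrow>
   foldr (\<lambda>s acc. s \<otimes>\<^bsub>G Mod H\<^esub> acc) (map (\<lambda>g. H #> g) gs) \<one>\<^bsub>G Mod H\<^esub> = H #> foldr (\<otimes>) gs \<one>"
  by (induction gs) (simp_all add: coset_mult_one subset rcos_sum foldr_mult_closed)

lemma FactGroup_word_iff:
  assumes "S \<subseteq> carrier G" "x \<in> carrier G" "y \<in> carrier G"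
  shows "(\<exists>ws. length ws = n \<and> set ws \<subseteq> (\<lambda>g. H #> g) ` S \<and>
            (H #> x) \<otimes>\<^bsub>G Mod H\<^esub> foldr (\<lambda>s acc. s \<otimes>\<^bsub>G Mod H\<^esub> acc) ws \<one>\<^bsub>G Mod H\<^esub> = H #> y)
     \<longleftrightarrow> (\<exists>gs. length gs = n \<and> set gs \<subseteq> S \<and> H #> foldr (\<otimes>) gs \<one> = H #> (inv x \<otimes> y))"
proof -
  have "(H #> x) \<otimes>\<^bsub>G Mod H\<^esub> foldr (\<lambda>s acc. s \<otimes>\<^bsub>G Mod H\<^esub> acc) (map (\<lambda>g. H #> g) gs) \<one>\<^bsub>G Mod H\<^esub> = H #> y
      \<longleftrightarrow> H #> foldr (\<otimes>) gs \<one> = H #> (inv x \<otimes> y)" if "set gs \<subseteq> S" for gs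
  proof -
    have "set gs \<subseteq> carrier G" using that assms(1) by blast
    then show ?thesis
      using assms
      by (simp only: FactGroup_foldr) (simp add: rcos_sum rcos_mult_eq_iff foldr_mult_closed)
  qed
  moreover have "set ws \<subseteq> (\<lambda>g. H #> g) ` S \<longleftrightarrow> (\<exists>gs. set gs \<subseteq> S \<and> ws = map (\<lambda>g. H #> g) gs)" for ws
  proof
    assume "set ws \<subseteq> (\<lambda>g. H #> g) ` S"
    then have "ws \<in> lists ((\<lambda>g. H #> g) ` S)" by blast
    then have "ws \<in> map (\<lambda>g. H #> g) ` lists S" by (simp only: lists_image)
    then show "\<exists>gs. set gs \<subseteq> S \<and> ws = map (\<lambda>g. H #> g) gs" by blast
  qed force
  ultimately show ?thesis by (metis length_map)
qed

lemma cay_dist_FactGroup: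
  assumes "S \<subseteq> carrier G" "x \<in> carrier G" "y \<in> carrier G"
  shows "cay_dist (G Mod H) ((\<lambda>g. H #> g) ` S) (H #> x) (H #> y) =
    (LEAST n. \<exists>gs. length gs = n \<and> set gs \<subseteq> S \<and> H #> foldr (\<otimes>) gs \<one> = H #> (inv x \<otimes> y))"
  unfolding cay_dist_def FactGroup_word_iff[OF assms] ..

lemma rcos_eq_if_inv_mult_mem:
  assumes "z \<in> carrier G" "w \<in> carrier G" "inv z \<otimes> w \<in> H"
  shows "H #> w = H #> z"
proof -
  have "H #> w = (H #> z) <#> (H #> (inv z \<otimes> w))"
    using assms by (simp add: rcos_sum m_assoc[symmetric])
  also have "H #> (inv z \<otimes> w) = H #> \<one>"
    using assms by (simp add: coset_join2 coset_mult_one subset subgroup_axioms)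
  finally show ?thesis
    using assms by (simp add: rcos_sum)
qed

lemma rcos_eq_imp_mult:
  assumes "w \<in> carrier G" "H #> w = H #> y"
  shows "\<exists>h\<in>H. w = h \<otimes> y"
  using repr_independenceD[OF subgroup_axioms assms(1) assms(2)[symmetric]]
  unfolding r_coset_def by blast

end

lemma cay_dist_le_cay_diam:
  assumes "\<And>x y. x \<in> carrier G \<Longrightarrow> y \<in> carrier G \<Longrightarrow> cay_dist G S x y \<le> B"
    and "x \<in> carrier G" "y \<in> carrier G"
  shows "cay_dist G S x y \<le> cay_diam G S"
  unfolding cay_diam_def
proof (rule cSup_upper)
  show "bdd_above {cay_dist G S x y |x y. x \<in> carrier G \<and> y \<in> carrier G}"
    using assms(1) by (auto intro!: bdd_aboveI[of _ B])
qed (use assms in blast)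

lemma cay_diam_le:
  assumes "\<And>x y. x \<in> carrier G \<Longrightarrow> y \<in> carrier G \<Longrightarrow> cay_dist G S x y \<le> B"
  shows "cay_diam G S \<le> B"
  unfolding cay_diam_def
  by (cases "carrier G = {}") (auto intro!: cSup_least simp: assms)

section \<open>Affine matrices\<close>

lemma mat2_eq_iff:
  "mat2 a b c d = mat2 a' b' c' d' \<longleftrightarrow> a = a' \<and> b = b' \<and> c = c' \<and> d = d'"
  by (auto simp: mat2_def vec_eq_iff forall_2)

lemma mat2_mult:
  "mat2 a b c d ** mat2 a' b' c' d' = mat2 (a*a'+b*c') (a*b'+b*d') (c*a'+d*c') (c*b'+d*d')"
  by (simp add: mat2_def vec_eq_iff forall_2 matrix_matrix_mult_def sum_2)

lemma mat_1_eq_mat2: "(mat 1 :: rat^2^2) = mat2 1 0 0 1"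
  by (simp add: mat2_def vec_eq_iff forall_2 mat_def)

lemma foldr_matrix_mult_append:
  "foldr (**) (xs @ ys) (mat 1) = foldr (**) xs (mat 1) ** foldr (**) ys (mat 1)"
  for xs ys :: "('a::semiring_1^'n^'n) list"
  by (induction xs) (auto simp: matrix_mul_assoc)

lemma foldr_replicate_Amat: "foldr (**) (replicate k Amat) (mat 1) = mat2 1 (of_nat k) 0 1"
  by (induction k) (simp_all add: mat_1_eq_mat2 Amat_def mat2_mult add.commute del: foldr_replicate)

lemma foldr_replicate_Tmat: "foldr (**) (replicate k (Tmat m)) (mat 1) = mat2 (of_nat m ^ k) 0 0 1"
  by (induction k) (simp_all add: mat_1_eq_mat2 Tmat_def mat2_mult del: foldr_replicate)

section \<open>Congruences in \<open>\<int>[1/m]\<close>\<close>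

definition Zinv :: "nat \<Rightarrow> rat set" where
  "Zinv m = {of_int c / of_nat m ^ l | c l. True}"

lemma Zinv_of_int: "of_int c \<in> Zinv m"
  unfolding Zinv_def by (rule CollectI, rule exI[of _ c], rule exI[of _ 0]) simp

lemma Zinv_pow_ratio: "of_nat m ^ i / of_nat m ^ j \<in> Zinv m"
  unfolding Zinv_def by (rule CollectI, rule exI[of _ "int m ^ i"], rule exI[of _ j]) simp

lemma Zinv_divide: "x \<in> Zinv m \<Longrightarrow> x / of_nat m \<in> Zinv m"
  unfolding Zinv_def by (auto intro!: exI[of _ "Suc _"] simp: mult.commute)

lemma Zinv_uminus:
  assumes "x \<in> Zinv m" shows "- x \<in> Zinv m"
proof -
  obtain a k where "x = of_int a / of_nat m ^ k" using assms by (auto simp: Zinv_def)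
  then have "- x = of_int (- a) / of_nat m ^ k" by simp
  then show ?thesis unfolding Zinv_def by blast
qed

lemma Zinv_mult:
  assumes "x \<in> Zinv m" "y \<in> Zinv m" shows "x * y \<in> Zinv m"
proof -
  obtain a k b l where "x = of_int a / of_nat m ^ k" "y = of_int b / of_nat m ^ l"
    using assms by (auto simp: Zinv_def)
  then have "x * y = of_int (a * b) / of_nat m ^ (k + l)" by (simp add: power_add)
  then show ?thesis unfolding Zinv_def by blast
qed

lemma Zinv_add:
  assumes "m > 0" "x \<in> Zinv m" "y \<in> Zinv m" shows "x + y \<in> Zinv m"
proof -
  obtain a k b l where xy: "x = of_int a / of_nat m ^ k" "y = of_int b / of_nat m ^ l"
    using assms by (auto simp: Zinv_def)
  have "(of_nat m :: rat) ^ k \<noteq> 0" "(of_nat m :: rat) ^ l \<noteq> 0" using assms(1) by auto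
  then have "x + y = of_int (a * int m ^ l + b * int m ^ k) / of_nat m ^ (k + l)"
    unfolding xy by (simp add: add_frac_eq power_add algebra_simps)
  then show ?thesis unfolding Zinv_def by blast
qed

lemma congN_zero_iff: "congN m N x 0 \<longleftrightarrow> (\<exists>z \<in> Zinv m. x = of_nat N * z)"
proof
  assume "congN m N x 0"
  then obtain a j where "x = of_nat N * (of_int a / of_nat m ^ j)" by (auto simp: congN_def)
  then show "\<exists>z \<in> Zinv m. x = of_nat N * z" unfolding Zinv_def by blast
qed (auto simp: congN_def Zinv_def, blast)

lemma congN_zero_zero: "congN m N 0 0"
  using Zinv_of_int[of 0] by (auto simp: congN_zero_iff)

lemma congN_zero_add: "m > 0 \<Longrightarrow> congN m N x 0 \<Longrightarrow> congN m N y 0 \<Longrightarrow> congN m N (x + y) 0"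
  by (auto simp: congN_zero_iff distrib_left[symmetric] intro!: bexI[of _ "_ + _"] Zinv_add)

lemma congN_zero_mult: "q \<in> Zinv m \<Longrightarrow> congN m N x 0 \<Longrightarrow> congN m N (q * x) 0"
  by (auto simp: congN_zero_iff intro!: bexI[of _ "q * _"] Zinv_mult)

lemma congN_zero_uminus: "congN m N x 0 \<Longrightarrow> congN m N (- x) 0"
  by (auto simp: congN_zero_iff intro!: bexI[of _ "- _"] Zinv_uminus)

lemma congN_pow_ratio_iff:
  assumes "m > 0" "coprime N m"
  shows "congN m N (of_nat m ^ i / of_nat m ^ j - 1) 0 \<longleftrightarrow> [m ^ i = m ^ j] (mod N)"
proof -
  have mp: "(of_nat m :: rat) ^ k \<noteq> 0" for k using assms(1) by simp
  have "congN m N (of_nat m ^ i / of_nat m ^ j - 1) 0 \<longleftrightarrow>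
    (\<exists>t l. (of_nat m ^ i - of_nat m ^ j :: rat) * of_nat m ^ l = of_nat N * of_int t * of_nat m ^ j)"
    using mp by (auto simp: congN_def field_simps)
  also have "\<dots> \<longleftrightarrow> (\<exists>t l. (int m ^ i - int m ^ j) * int m ^ l = int N * t * int m ^ j)"
  proof (intro ex_cong1)
    fix t l
    have "(of_nat m ^ i - of_nat m ^ j :: rat) * of_nat m ^ l = of_int ((int m ^ i - int m ^ j) * int m ^ l)"
      "of_nat N * of_int t * of_nat m ^ j = (of_int (int N * t * int m ^ j) :: rat)"
      by simp_all
    then show "(of_nat m ^ i - of_nat m ^ j :: rat) * of_nat m ^ l = of_nat N * of_int t * of_nat m ^ j
      \<longleftrightarrow> (int m ^ i - int m ^ j) * int m ^ l = int N * t * int m ^ j"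
      by (simp only: of_int_eq_iff)
  qed
  also have "\<dots> \<longleftrightarrow> int N dvd int m ^ i - int m ^ j"
  proof
    assume "\<exists>t l. (int m ^ i - int m ^ j) * int m ^ l = int N * t * int m ^ j"
    then obtain t l where "(int m ^ i - int m ^ j) * int m ^ l = int N * (t * int m ^ j)"
      by (auto simp: mult.assoc)
    then have "int N dvd (int m ^ i - int m ^ j) * int m ^ l" by (rule dvdI)
    moreover have "coprime (int N) (int m ^ l)" using assms(2) by simp
    ultimately show "int N dvd int m ^ i - int m ^ j" using coprime_dvd_mult_left_iff by blast
  next
    assume "int N dvd int m ^ i - int m ^ j"
    then obtain t where "int m ^ i - int m ^ j = int N * t" by blast
    then show "\<exists>t l. (int m ^ i - int m ^ j) * int m ^ l = int N * t * int m ^ j"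
      by (intro exI[of _ t] exI[of _ j]) simp
  qed
  also have "\<dots> \<longleftrightarrow> [m ^ i = m ^ j] (mod N)"
    by (simp add: cong_iff_dvd_diff cong_int_iff[symmetric])
  finally show ?thesis .
qed

lemma N_le_pow_ord:
  fixes m N :: nat
  assumes "m \<ge> 2" "N \<ge> 2" "coprime N m"
  shows "N \<le> m ^ ord N m"
proof (rule ccontr)
  assume "\<not> N \<le> m ^ ord N m"
  then have "m ^ ord N m = 1"
    using ord[of m N] assms(2) by (simp add: cong_def)
  moreover have "m ^ 1 \<le> m ^ ord N m"
    using assms by (intro power_increasing) (auto simp: Suc_le_eq)
  ultimately show False using assms(1) by simp
qed

lemma exists_nat_congN:
  assumes "m > 0" "N > 0" "coprime N m" "b \<in> Zinv m"
  shows "\<exists>r < N. congN m N (of_nat r - b) 0"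
proof -
  obtain c l where b: "b = of_int c / of_nat m ^ l" using assms(4) by (auto simp: Zinv_def)
  have "coprime (int m ^ l) (int N)" using assms(3) by (simp add: coprime_commute)
  then obtain x where x: "[int m ^ l * x = 1] (mod int N)" using cong_solve_coprime_int by blast
  define r where "r = nat ((c * x) mod int N)"
  have "0 \<le> (c * x) mod int N" "(c * x) mod int N < int N" using assms(2) by simp_all
  then have r: "int r = (c * x) mod int N" "r < N" by (simp_all add: r_def nat_less_iff)
  have "[int r * int m ^ l = c * x * int m ^ l] (mod int N)"
    unfolding r(1) by (simp add: cong_def mod_mult_left_eq)
  also have "[c * x * int m ^ l = c * 1] (mod int N)"
    using cong_scalar_left[OF x, of c] by (simp add: ac_simps)
  finally obtain t where t: "int r * int m ^ l - c = int N * t"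
    by (auto simp: cong_iff_dvd_diff dvd_def)
  have "(of_nat r - b :: rat) = of_int (int r * int m ^ l - c) / of_nat m ^ l"
    using assms(1) unfolding b by (simp add: field_simps)
  also have "\<dots> = of_nat N * of_int t / of_nat m ^ l" unfolding t by simp
  finally show ?thesis using r(2) unfolding congN_def by auto
qed

lemma ex_pow_shift_cong:
  fixes m N :: nat
  assumes "coprime N m"
  shows "\<exists>k < ord N m. [m ^ (k + j) = m ^ i] (mod N)"
proof -
  define d where "d = ord N m"
  have "d > 0" using assms by (simp add: d_def)
  define k where "k = (i + (d - 1) * j) mod d"
  have "(k + j) mod d = (i + ((d - 1) * j + j)) mod d"
    by (simp add: k_def mod_add_left_eq add.assoc)
  also have "(d - 1) * j + j = d * j" using \<open>d > 0\<close> by (cases d) simp_all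
  finally have "[m ^ (k + j) = m ^ i] (mod N)"
    using order_divides_expdiff[OF assms] by (simp add: cong_def d_def)
  moreover have "k < d" using \<open>d > 0\<close> by (simp add: k_def)
  ultimately show ?thesis by (auto simp: d_def)
qed

section \<open>The group \<open>G_m\<close> and its congruence subgroup \<open>G_m(N)\<close>\<close>

lemma Gm_word_form:
  assumes "m > 0" "set ws \<subseteq> gens m"
  shows "\<exists>i j b. foldr (**) ws (mat 1) = mat2 (of_nat m ^ i / of_nat m ^ j) b 0 1 \<and> b \<in> Zinv m
     \<and> i + j \<le> length ws"
  using assms(2)
proof (induction ws)
  case Nil
  show ?case
    using Zinv_of_int[of 0 m] by (auto simp: mat_1_eq_mat2 intro!: exI[of _ 0])
next
  case (Cons g ws)
  then obtain i j b where ws: "foldr (**) ws (mat 1) = mat2 (of_nat m ^ i / of_nat m ^ j) b 0 1"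
    "b \<in> Zinv m" "i + j \<le> length ws"
    by auto
  have "g \<in> gens m" using Cons.prems by simp
  then consider "g = Amat" | "g = Ainv" | "g = Tmat m" | "g = Tinv m" by (auto simp: gens_def)
  then show ?case
  proof cases
    case 1
    then show ?thesis
      using ws Zinv_add[OF assms(1) ws(2) Zinv_of_int[of 1]]
      by (intro exI[of _ i] exI[of _ j] exI[of _ "b + 1"]) (simp add: Amat_def mat2_mult)
  next
    case 2
    then show ?thesis
      using ws Zinv_add[OF assms(1) ws(2) Zinv_of_int[of "-1"]]
      by (intro exI[of _ i] exI[of _ j] exI[of _ "b - 1"]) (simp add: Ainv_def mat2_mult)
  next
    case 3
    then show ?thesis
      using ws Zinv_mult[OF Zinv_of_int[of "int m"] ws(2)]
      by (intro exI[of _ "Suc i"] exI[of _ j] exI[of _ "of_nat m * b"]) (simp add: Tmat_def mat2_mult)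
  next
    case 4
    then show ?thesis
      using ws Zinv_divide[OF ws(2)]
      by (intro exI[of _ i] exI[of _ "Suc j"] exI[of _ "b / of_nat m"]) (simp add: Tinv_def mat2_mult)
  qed
qed

lemma gens_inverse: "m > 0 \<Longrightarrow> g \<in> gens m \<Longrightarrow> \<exists>g' \<in> gens m. g' ** g = mat 1"
  unfolding gens_def
  by (auto simp: Amat_def Ainv_def Tmat_def Tinv_def mat2_mult mat_1_eq_mat2)

lemma Gm_simps [simp]:
  "carrier (Gm m) = Gm_carrier m" "monoid.mult (Gm m) = (**)" "one (Gm m) = mat 1"
  by (simp_all add: Gm_def)

lemma word_in_Gm_carrier: "set ws \<subseteq> gens m \<Longrightarrow> foldr (**) ws (mat 1) \<in> Gm_carrier m"
  by (auto simp: Gm_carrier_def)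

lemma gens_subset_Gm_carrier: "gens m \<subseteq> Gm_carrier m"
  using word_in_Gm_carrier[of "[_]" m] by auto

lemma Gm_group: assumes "m > 0" shows "group (Gm m)"
proof (rule groupI)
  fix x assume "x \<in> carrier (Gm m)"
  then obtain xs where x: "x = foldr (**) xs (mat 1)" "set xs \<subseteq> gens m"
    by (auto simp: Gm_carrier_def)
  have "\<exists>ys. set ys \<subseteq> gens m \<and> foldr (**) ys (mat 1) ** foldr (**) xs (mat 1) = mat 1"
    using x(2)
  proof (induction xs)
    case (Cons g xs)
    then obtain ys where ys: "set ys \<subseteq> gens m" "foldr (**) ys (mat 1) ** foldr (**) xs (mat 1) = mat 1"
      by auto
    obtain g' where g': "g' \<in> gens m" "g' ** g = mat 1"
      using gens_inverse[OF assms, of g] Cons.prems by auto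
    have "foldr (**) (ys @ [g']) (mat 1) ** foldr (**) (g # xs) (mat 1)
        = foldr (**) ys (mat 1) ** ((g' ** g) ** foldr (**) xs (mat 1))"
      by (simp only: foldr_matrix_mult_append) (simp add: matrix_mul_assoc)
    then show ?case using ys g' by (intro exI[of _ "ys @ [g']"]) auto
  qed (auto intro!: exI[of _ "[]"])
  then show "\<exists>y\<in>carrier (Gm m). y \<otimes>\<^bsub>Gm m\<^esub> x = \<one>\<^bsub>Gm m\<^esub>"
    using x by (auto simp: Gm_carrier_def)
next
  fix x y assume "x \<in> carrier (Gm m)" "y \<in> carrier (Gm m)"
  then obtain xs ys where "x = foldr (**) xs (mat 1)" "set xs \<subseteq> gens m"
     "y = foldr (**) ys (mat 1)" "set ys \<subseteq> gens m"
    by (auto simp: Gm_carrier_def)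
  then show "x \<otimes>\<^bsub>Gm m\<^esub> y \<in> carrier (Gm m)"
    using word_in_Gm_carrier[of "xs @ ys" m] by (simp add: foldr_matrix_mult_append del: foldr_append)
qed (auto simp: matrix_mul_assoc intro: word_in_Gm_carrier[of "[]", simplified])

lemma Gm_carrier_form:
  assumes "m > 0" "g \<in> Gm_carrier m"
  shows "\<exists>i j b. g = mat2 (of_nat m ^ i / of_nat m ^ j) b 0 1 \<and> b \<in> Zinv m"
proof -
  obtain ws where "g = foldr (**) ws (mat 1)" "set ws \<subseteq> gens m"
    using assms(2) by (auto simp: Gm_carrier_def)
  then show ?thesis using Gm_word_form[OF assms(1)] by blast
qed

lemma Gm_inv:
  assumes "m > 0" "x \<in> Gm_carrier m" "x = mat2 u b 0 1"
  shows "inv\<^bsub>Gm m\<^esub> x = mat2 (1/u) (-b/u) 0 1"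
proof -
  interpret group "Gm m" by (rule Gm_group[OF assms(1)])
  obtain v b' where y: "inv\<^bsub>Gm m\<^esub> x = mat2 v b' 0 1"
    using Gm_carrier_form[OF assms(1)] inv_closed assms(2) by fastforce
  have "mat2 v b' 0 1 ** x = mat 1"
    using l_inv assms(2) unfolding y[symmetric] by simp
  then have "mat2 v b' 0 1 ** mat2 u b 0 1 = mat2 1 0 0 1"
    by (simp only: assms(3) mat_1_eq_mat2)
  then have "v * u = 1" "b' = - v * b"
    by (simp_all add: mat2_mult mat2_eq_iff eq_neg_iff_add_eq_0 add.commute)
  then have "v = 1 / u" "b' = - b / u"
    by (auto simp: eq_divide_eq)
  then show ?thesis
    unfolding y by simp
qed

lemma mat2_in_GmN_iff:
  "mat2 u b 0 1 \<in> GmN m N \<longleftrightarrow>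
   mat2 u b 0 1 \<in> Gm_carrier m \<and> congN m N (u - 1) 0 \<and> congN m N b 0"
proof -
  have "congN m N u 1 \<longleftrightarrow> congN m N (u - 1) 0" "congN m N 1 1"
    by (auto simp: congN_def intro: exI[of _ 0])
  then show ?thesis
    using congN_zero_zero[of m N]
    by (simp add: GmN_def forall_2 mat_1_eq_mat2 mat2_def)
qed

lemma GmN_form:
  assumes "m > 0" "h \<in> GmN m N"
  shows "\<exists>i j b. h = mat2 (of_nat m ^ i / of_nat m ^ j) b 0 1 \<and>
     congN m N (of_nat m ^ i / of_nat m ^ j - 1) 0 \<and> congN m N b 0"
  using Gm_carrier_form[OF assms(1)] assms(2) mat2_in_GmN_iff unfolding GmN_def by blast

lemma GmN_subgroup: assumes "m > 0" shows "subgroup (GmN m N) (Gm m)"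
proof -
  interpret group "Gm m" by (rule Gm_group[OF assms])
  show ?thesis
  proof (rule subgroupI)
    show "GmN m N \<subseteq> carrier (Gm m)" by (auto simp: GmN_def)
  next
    have "mat2 1 0 0 1 \<in> GmN m N"
      using word_in_Gm_carrier[of "[]" m] congN_zero_zero[of m N]
      by (simp add: mat_1_eq_mat2 mat2_in_GmN_iff)
    then show "GmN m N \<noteq> {}" by blast
  next
    fix h assume h: "h \<in> GmN m N"
    then obtain i j b where hf: "h = mat2 (of_nat m ^ i / of_nat m ^ j) b 0 1"
      "congN m N (of_nat m ^ i / of_nat m ^ j - 1) 0" "congN m N b 0"
      using GmN_form[OF assms] by blast
    let ?u = "of_nat m ^ i / of_nat m ^ j :: rat"
    have hc: "h \<in> Gm_carrier m" using h by (simp add: GmN_def)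
    have inv: "inv\<^bsub>Gm m\<^esub> h = mat2 (1/?u) (-b/?u) 0 1" by (rule Gm_inv[OF assms hc hf(1)])
    have "inv\<^bsub>Gm m\<^esub> h \<in> Gm_carrier m" using inv_closed[of h] hc by simp
    moreover have "1/?u - 1 = (of_nat m ^ j / of_nat m ^ i) * - (?u - 1)"
      "-b/?u = (of_nat m ^ j / of_nat m ^ i) * - b"
      using assms by (simp_all add: field_simps)
    then have "congN m N (1/?u - 1) 0" "congN m N (-b/?u) 0"
      using hf(2,3) by (simp_all only: congN_zero_mult[OF Zinv_pow_ratio] congN_zero_uminus)
    ultimately show "inv\<^bsub>Gm m\<^esub> h \<in> GmN m N"
      unfolding inv mat2_in_GmN_iff by blast
  next
    fix h h' assume h: "h \<in> GmN m N" and h': "h' \<in> GmN m N"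
    obtain i j b where hf: "h = mat2 (of_nat m ^ i / of_nat m ^ j) b 0 1"
      "congN m N (of_nat m ^ i / of_nat m ^ j - 1) 0" "congN m N b 0"
      using GmN_form[OF assms h] by blast
    obtain i' j' b' where hf': "h' = mat2 (of_nat m ^ i' / of_nat m ^ j') b' 0 1"
      "congN m N (of_nat m ^ i' / of_nat m ^ j' - 1) 0" "congN m N b' 0"
      using GmN_form[OF assms h'] by blast
    let ?u = "of_nat m ^ i / of_nat m ^ j :: rat"
    let ?v = "of_nat m ^ i' / of_nat m ^ j' :: rat"
    have "h ** h' \<in> Gm_carrier m" using m_closed[of h h'] h h' by (simp add: GmN_def)
    moreover have "h ** h' = mat2 (?u * ?v) (?u * b' + b) 0 1" using hf(1) hf'(1) by (simp add: mat2_mult)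
    moreover have "?u * ?v - 1 = ?v * (?u - 1) + (?v - 1)" by (simp add: algebra_simps)
    then have "congN m N (?u * ?v - 1) 0"
      using congN_zero_add[OF assms congN_zero_mult[OF Zinv_pow_ratio hf(2)] hf'(2)] by metis
    moreover have "congN m N (?u * b' + b) 0"
      by (rule congN_zero_add[OF assms congN_zero_mult[OF Zinv_pow_ratio hf'(3)] hf(3)])
    ultimately show "h \<otimes>\<^bsub>Gm m\<^esub> h' \<in> GmN m N"
      by (simp only: Gm_simps mat2_in_GmN_iff)
  qed
qed

lemma GmN_normal: assumes "m > 0" shows "GmN m N \<lhd> Gm m"
proof -
  interpret group "Gm m" by (rule Gm_group[OF assms])
  show ?thesis
  proof (rule normal_invI[OF GmN_subgroup[OF assms]])
    fix x h assume x: "x \<in> carrier (Gm m)" and h: "h \<in> GmN m N"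
    obtain i j b where xf: "x = mat2 (of_nat m ^ i / of_nat m ^ j) b 0 1" "b \<in> Zinv m"
      using Gm_carrier_form[OF assms] x by (metis Gm_simps(1))
    obtain i' j' d where hf: "h = mat2 (of_nat m ^ i' / of_nat m ^ j') d 0 1"
      "congN m N (of_nat m ^ i' / of_nat m ^ j' - 1) 0" "congN m N d 0"
      using GmN_form[OF assms h] by blast
    let ?u = "of_nat m ^ i / of_nat m ^ j :: rat"
    let ?v = "of_nat m ^ i' / of_nat m ^ j' :: rat"
    have "h \<in> carrier (Gm m)" using h by (simp add: GmN_def)
    then have "x \<otimes>\<^bsub>Gm m\<^esub> h \<otimes>\<^bsub>Gm m\<^esub> inv\<^bsub>Gm m\<^esub> x \<in> Gm_carrier m"
      using x by (metis Gm_simps(1) inv_closed m_closed)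
    moreover have "x \<otimes>\<^bsub>Gm m\<^esub> h \<otimes>\<^bsub>Gm m\<^esub> inv\<^bsub>Gm m\<^esub> x = mat2 ?v (?u * d + (- b) * (?v - 1)) 0 1"
      using Gm_inv[OF assms _ xf(1)] x assms
      by (simp add: xf(1) hf(1) mat2_mult mat2_eq_iff field_simps)
    moreover have "congN m N (?u * d + (- b) * (?v - 1)) 0"
      by (rule congN_zero_add[OF assms congN_zero_mult[OF Zinv_pow_ratio hf(3)]
            congN_zero_mult[OF Zinv_uminus[OF xf(2)] hf(2)]])
    ultimately show "x \<otimes>\<^bsub>Gm m\<^esub> h \<otimes>\<^bsub>Gm m\<^esub> inv\<^bsub>Gm m\<^esub> x \<in> GmN m N"
      using hf(2) by (simp add: mat2_in_GmN_iff)
  qed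
qed

lemma Amat_notin_GmN:
  assumes "m > 0" "N \<ge> 2" "coprime N m"
  shows "Amat \<notin> GmN m N"
proof
  assume "Amat \<in> GmN m N"
  then obtain t l where "(1 :: rat) = of_nat N * of_int t / of_nat m ^ l"
    by (auto simp: Amat_def mat2_in_GmN_iff congN_def)
  then have "(of_int (int m ^ l) :: rat) = of_int (int N * t)"
    using assms(1) by (simp add: field_simps)
  then have "int N dvd int m ^ l" by (metis dvdI of_int_eq_iff)
  moreover have "coprime (int N) (int m ^ l)" using assms(3) by simp
  ultimately have "is_unit (int N)" using coprime_absorb_left by blast
  then show False using assms(2) by simp
qed

section \<open>The Cayley graph of \<open>G_m / G_m(N)\<close>\<close>

lemma cay_dist_Qgrp:
  assumes "m > 0" "g1 \<in> Gm_carrier m" "g2 \<in> Gm_carrier m"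
  shows "cay_dist (Qgrp m N) (Qgens m N) (GmN m N #>\<^bsub>Gm m\<^esub> g1) (GmN m N #>\<^bsub>Gm m\<^esub> g2) =
    (LEAST n. \<exists>gs. length gs = n \<and> set gs \<subseteq> gens m \<and>
       GmN m N #>\<^bsub>Gm m\<^esub> foldr (**) gs (mat 1) = GmN m N #>\<^bsub>Gm m\<^esub> (inv\<^bsub>Gm m\<^esub> g1 ** g2))"
proof -
  interpret normal "GmN m N" "Gm m" by (rule GmN_normal[OF assms(1)])
  have "Qgens m N = (\<lambda>g. GmN m N #>\<^bsub>Gm m\<^esub> g) ` gens m" by (auto simp: Qgens_def)
  then show ?thesis
    unfolding Qgrp_def using cay_dist_FactGroup[of "gens m" g1 g2] gens_subset_Gm_carrier assms
    by simp
qed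

text \<open>Base-\<open>m\<close> expansion: \<open>A^r = A^(r mod m) T A^(r div m) T^-1\<close>.\<close>

lemma translation_short_word:
  assumes "m > 0" "r < m ^ d"
  shows "\<exists>ws. set ws \<subseteq> gens m \<and> length ws \<le> (m + 1) * d \<and>
     foldr (**) ws (mat 1) = mat2 1 (of_nat r) 0 1"
  using assms(2)
proof (induction d arbitrary: r)
  case 0
  then show ?case by (intro exI[of _ "[]"]) (simp add: mat_1_eq_mat2)
next
  case (Suc d)
  have "r div m < m ^ d" using Suc.prems assms(1) by (simp add: div_less_iff_less_mult mult.commute)
  then obtain ws where ws: "set ws \<subseteq> gens m" "length ws \<le> (m + 1) * d"
    "foldr (**) ws (mat 1) = mat2 1 (of_nat (r div m)) 0 1"
    using Suc.IH by blast
  define vs where "vs = replicate (r mod m) Amat @ [Tmat m] @ ws @ [Tinv m]"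
  have "set vs \<subseteq> gens m" using ws(1) by (auto simp: vs_def gens_def)
  moreover have "length vs \<le> (m + 1) * Suc d"
    using ws(2) mod_less_divisor[OF assms(1), of r] by (simp add: vs_def)
  moreover have "(of_nat r :: rat) = of_nat m * of_nat (r div m) + of_nat (r mod m)"
    by (metis of_nat_add of_nat_mult div_mult_mod_eq mult.commute)
  then have "foldr (**) vs (mat 1) = mat2 1 (of_nat r) 0 1"
    using assms(1)
    by (simp add: vs_def foldr_matrix_mult_append foldr_replicate_Amat ws(3) Tmat_def Tinv_def mat2_mult
        del: foldr_replicate foldr_append)
  ultimately show ?case by blast
qed

lemma Gm_short_word_mod_GmN:
  assumes "m \<ge> 2" "N \<ge> 2" "coprime N m" "z \<in> Gm_carrier m"
  shows "\<exists>gs. set gs \<subseteq> gens m \<and> length gs \<le> (m + 2) * ord N m \<and>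
     GmN m N #>\<^bsub>Gm m\<^esub> foldr (**) gs (mat 1) = GmN m N #>\<^bsub>Gm m\<^esub> z"
proof -
  have m: "m > 0" using assms(1) by simp
  define d where "d = ord N m"
  obtain i j b where z: "z = mat2 (of_nat m ^ i / of_nat m ^ j) b 0 1" "b \<in> Zinv m"
    using Gm_carrier_form[OF m assms(4)] by blast
  obtain r where r: "r < N" "congN m N (of_nat r - b) 0"
    using exists_nat_congN[OF m _ assms(3) z(2)] assms(2) by auto
  obtain k where "k < d" "[m ^ (k + j) = m ^ i] (mod N)"
    using ex_pow_shift_cong[OF assms(3)] by (auto simp: d_def)
  obtain us where us: "set us \<subseteq> gens m" "length us \<le> (m + 1) * d"
    "foldr (**) us (mat 1) = mat2 1 (of_nat r) 0 1"
    using translation_short_word[OF m, of r d] r(1) N_le_pow_ord[OF assms(1-3)] by (auto simp: d_def)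
  \<comment> \<open>The word for \<open>A^r T^k\<close>; it is congruent to \<open>z\<close> as \<open>r \<equiv> b\<close> and \<open>m^k \<equiv> m^(i-j)\<close> mod \<open>N\<close>.\<close>
  define gs where "gs = us @ replicate k (Tmat m)"
  have gs: "set gs \<subseteq> gens m" using us(1) by (auto simp: gs_def gens_def)
  have w: "foldr (**) gs (mat 1) = mat2 (of_nat m ^ k) (of_nat r) 0 1"
    by (simp add: gs_def foldr_matrix_mult_append us(3) foldr_replicate_Tmat mat2_mult
        del: foldr_replicate foldr_append)
  have "inv\<^bsub>Gm m\<^esub> z ** foldr (**) gs (mat 1) =
    mat2 (of_nat m ^ (k + j) / of_nat m ^ i) ((of_nat m ^ j / of_nat m ^ i) * (of_nat r - b)) 0 1"
    using m unfolding Gm_inv[OF m assms(4) z(1)] w mat2_mult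
    by (simp add: mat2_eq_iff field_simps power_add)
  moreover have "inv\<^bsub>Gm m\<^esub> z ** foldr (**) gs (mat 1) \<in> Gm_carrier m"
    using assms(4) word_in_Gm_carrier[OF gs] group.inv_closed[OF Gm_group[OF m]]
      monoid.m_closed[OF group.is_monoid[OF Gm_group[OF m]]]
    by (metis Gm_simps)
  ultimately have "inv\<^bsub>Gm m\<^esub> z \<otimes>\<^bsub>Gm m\<^esub> foldr (**) gs (mat 1) \<in> GmN m N"
    using congN_pow_ratio_iff[OF m assms(3)] \<open>[m ^ (k + j) = m ^ i] (mod N)\<close>
      congN_zero_mult[OF Zinv_pow_ratio r(2)]
    by (simp add: mat2_in_GmN_iff)
  then have "GmN m N #>\<^bsub>Gm m\<^esub> foldr (**) gs (mat 1) = GmN m N #>\<^bsub>Gm m\<^esub> z"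
    using normal.rcos_eq_if_inv_mult_mem[OF GmN_normal[OF m]] assms(4) word_in_Gm_carrier[OF gs]
    by simp
  moreover have "length gs \<le> (m + 2) * d"
    using us(2) \<open>k < d\<close> by (simp add: gs_def)
  ultimately show ?thesis using gs by (auto simp: d_def)
qed

lemma T_pow_coset_word_length:
  assumes "m \<ge> 2" "coprime N m" "set gs \<subseteq> gens m"
    and "GmN m N #>\<^bsub>Gm m\<^esub> foldr (**) gs (mat 1) =
         GmN m N #>\<^bsub>Gm m\<^esub> foldr (**) (replicate (ord N m div 2) (Tmat m)) (mat 1)"
  shows "ord N m div 2 \<le> length gs"
proof (rule ccontr)
  define s where "s = ord N m div 2"
  assume "\<not> ord N m div 2 \<le> length gs"
  then have short: "length gs < s" by (simp add: s_def)
  have m: "m > 0" using assms(1) by simp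
  obtain i j b where w: "foldr (**) gs (mat 1) = mat2 (of_nat m ^ i / of_nat m ^ j) b 0 1"
    "i + j \<le> length gs"
    using Gm_word_form[OF m assms(3)] by blast
  have coset: "GmN m N #>\<^bsub>Gm m\<^esub> foldr (**) gs (mat 1) = GmN m N #>\<^bsub>Gm m\<^esub> mat2 (of_nat m ^ s) 0 0 1"
    using assms(4) by (simp only: s_def foldr_replicate_Tmat)
  obtain h where h: "h \<in> GmN m N" "foldr (**) gs (mat 1) = h ** mat2 (of_nat m ^ s) 0 0 1"
    using normal.rcos_eq_imp_mult[OF GmN_normal[OF m] _ coset] word_in_Gm_carrier[OF assms(3)] by auto
  obtain i' j' e where hf: "h = mat2 (of_nat m ^ i' / of_nat m ^ j') e 0 1"
    "congN m N (of_nat m ^ i' / of_nat m ^ j' - 1) 0"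
    using GmN_form[OF m h(1)] by blast
  have "(of_nat m ^ i / of_nat m ^ j :: rat) = of_nat m ^ i' / of_nat m ^ j' * of_nat m ^ s"
    using h(2) unfolding w(1) hf(1) by (simp add: mat2_mult mat2_eq_iff)
  then have "(of_nat m ^ i' / of_nat m ^ j' :: rat) = of_nat m ^ i / of_nat m ^ (j + s)"
    using m by (simp add: field_simps power_add)
  then have "[m ^ i = m ^ (j + s)] (mod N)"
    using hf(2) congN_pow_ratio_iff[OF m assms(2)] by simp
  then have "i mod ord N m = (j + s) mod ord N m"
    using order_divides_expdiff[OF assms(2)] by (simp add: cong_def)
  moreover have "i < j + s" "j + s < ord N m"
    using short w(2) by (auto simp: s_def)
  ultimately show False by simp
qed

lemma Qgrp_cay_dist_le:
  assumes "m \<ge> 2" "N \<ge> 2" "coprime N m" "x \<in> carrier (Qgrp m N)" "y \<in> carrier (Qgrp m N)"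
  shows "cay_dist (Qgrp m N) (Qgens m N) x y \<le> (m + 2) * ord N m"
proof -
  have m: "m > 0" using assms(1) by simp
  obtain g1 g2 where g: "g1 \<in> Gm_carrier m" "g2 \<in> Gm_carrier m"
    "x = GmN m N #>\<^bsub>Gm m\<^esub> g1" "y = GmN m N #>\<^bsub>Gm m\<^esub> g2"
    using assms(4,5) by (auto simp: Qgrp_def carrier_FactGroup)
  have "inv\<^bsub>Gm m\<^esub> g1 ** g2 \<in> Gm_carrier m"
    using g(1,2) group.inv_closed[OF Gm_group[OF m]] monoid.m_closed[OF group.is_monoid[OF Gm_group[OF m]]]
    by (metis Gm_simps)
  then obtain gs where "set gs \<subseteq> gens m" "length gs \<le> (m + 2) * ord N m"
    "GmN m N #>\<^bsub>Gm m\<^esub> foldr (**) gs (mat 1) = GmN m N #>\<^bsub>Gm m\<^esub> (inv\<^bsub>Gm m\<^esub> g1 ** g2)"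
    using Gm_short_word_mod_GmN[OF assms(1-3)] by blast
  then show ?thesis
    unfolding g(3,4) cay_dist_Qgrp[OF m g(1,2)] by (auto intro: Least_le[THEN order_trans])
qed

lemma cay_dist_Qgrp_one_ge:
  assumes "m \<ge> 2" "N \<ge> 2" "coprime N m" "y \<in> Gm_carrier m"
    and "\<And>gs. set gs \<subseteq> gens m \<Longrightarrow>
      GmN m N #>\<^bsub>Gm m\<^esub> foldr (**) gs (mat 1) = GmN m N #>\<^bsub>Gm m\<^esub> y \<Longrightarrow> L \<le> length gs"
  shows "L \<le> cay_dist (Qgrp m N) (Qgens m N) (GmN m N #>\<^bsub>Gm m\<^esub> mat 1) (GmN m N #>\<^bsub>Gm m\<^esub> y)"
proof -
  have m: "m > 0" using assms(1) by simp
  have inv_one: "inv\<^bsub>Gm m\<^esub> mat 1 ** y = y"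
    using monoid.inv_one[OF group.is_monoid[OF Gm_group[OF m]]] by simp
  show ?thesis
    unfolding cay_dist_Qgrp[OF m word_in_Gm_carrier[of "[]", simplified] assms(4)] inv_one
  proof (rule LeastI2_ex)
    show "\<exists>n gs. length gs = n \<and> set gs \<subseteq> gens m \<and>
      GmN m N #>\<^bsub>Gm m\<^esub> foldr (**) gs (mat 1) = GmN m N #>\<^bsub>Gm m\<^esub> y"
      using Gm_short_word_mod_GmN[OF assms(1-4)] by blast
  qed (use assms(5) in blast)
qed

lemma ex_ord_le_three_cay_dist_Qgrp:
  assumes "m \<ge> 2" "N \<ge> 2" "coprime N m"
  shows "\<exists>x \<in> carrier (Qgrp m N). \<exists>y \<in> carrier (Qgrp m N).
    ord N m \<le> 3 * cay_dist (Qgrp m N) (Qgens m N) x y"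
proof -
  have m: "m > 0" using assms(1) by simp
  have in_Qgrp: "GmN m N #>\<^bsub>Gm m\<^esub> g \<in> carrier (Qgrp m N)" if "g \<in> Gm_carrier m" for g
    using that by (simp add: Qgrp_def carrier_FactGroup)
  have one: "mat 1 \<in> Gm_carrier m" using word_in_Gm_carrier[of "[]" m] by simp
  show ?thesis
  proof (cases "ord N m \<ge> 2")
    case True
    define T where "T = foldr (**) (replicate (ord N m div 2) (Tmat m)) (mat 1)"
    have T: "T \<in> Gm_carrier m" unfolding T_def by (rule word_in_Gm_carrier) (auto simp: gens_def)
    have "ord N m div 2 \<le> cay_dist (Qgrp m N) (Qgens m N) (GmN m N #>\<^bsub>Gm m\<^esub> mat 1) (GmN m N #>\<^bsub>Gm m\<^esub> T)"
      using T_pow_coset_word_length[OF assms(1,3)] by (intro cay_dist_Qgrp_one_ge[OF assms T]) (simp add: T_def)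
    then have "ord N m \<le> 3 * cay_dist (Qgrp m N) (Qgens m N) (GmN m N #>\<^bsub>Gm m\<^esub> mat 1) (GmN m N #>\<^bsub>Gm m\<^esub> T)"
      using True by linarith
    then show ?thesis using in_Qgrp[OF one] in_Qgrp[OF T] by blast
  next
    case False
    moreover have "ord N m > 0" using assms(3) by simp
    ultimately have "ord N m = 1" by linarith
    have A: "Amat \<in> Gm_carrier m" using gens_subset_Gm_carrier by (auto simp: gens_def)
    have "1 \<le> cay_dist (Qgrp m N) (Qgens m N) (GmN m N #>\<^bsub>Gm m\<^esub> mat 1) (GmN m N #>\<^bsub>Gm m\<^esub> Amat)"
    proof (rule cay_dist_Qgrp_one_ge[OF assms A], rule ccontr)
      fix gs assume coset: "GmN m N #>\<^bsub>Gm m\<^esub> foldr (**) gs (mat 1) = GmN m N #>\<^bsub>Gm m\<^esub> Amat"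
        and short: "\<not> 1 \<le> length gs"
      from short have "gs = []" by (cases gs) auto
      then have "Amat \<in> GmN m N"
        using normal.rcos_eq_imp_mult[OF GmN_normal[OF m] _ coset[symmetric]] A by auto
      then show False using Amat_notin_GmN[OF m assms(2,3)] by simp
    qed
    then show ?thesis using \<open>ord N m = 1\<close> in_Qgrp[OF one] in_Qgrp[OF A] by force
  qed
qed

theorem lemma3p3:
  fixes m :: nat
  assumes "m \<ge> 2"
  shows "\<exists>C::real. C > 0 \<and> (\<forall>N::nat. N \<ge> 2 \<and> coprime N m \<longrightarrow>
           real (ord N m) / 3 \<le> real (cay_diam (Qgrp m N) (Qgens m N)) \<and>
           real (cay_diam (Qgrp m N) (Qgens m N)) \<le> C * real (ord N m))"
proof (intro exI[of _ "real (m + 2)"] conjI allI impI)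
  fix N :: nat assume N: "N \<ge> 2 \<and> coprime N m"
  note upper = Qgrp_cay_dist_le[OF assms N[THEN conjunct1] N[THEN conjunct2]]
  obtain x y where "x \<in> carrier (Qgrp m N)" "y \<in> carrier (Qgrp m N)"
    and far: "ord N m \<le> 3 * cay_dist (Qgrp m N) (Qgens m N) x y"
    using ex_ord_le_three_cay_dist_Qgrp[OF assms] N by blast
  then have "cay_dist (Qgrp m N) (Qgens m N) x y \<le> cay_diam (Qgrp m N) (Qgens m N)"
    by (intro cay_dist_le_cay_diam[OF upper])
  then have "ord N m \<le> 3 * cay_diam (Qgrp m N) (Qgens m N)" using far by linarith
  then show "real (ord N m) / 3 \<le> real (cay_diam (Qgrp m N) (Qgens m N))"
    by (simp add: field_simps flip: of_nat_le_iff)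
  have "cay_diam (Qgrp m N) (Qgens m N) \<le> (m + 2) * ord N m" by (rule cay_diam_le[OF upper])
  then have "real (cay_diam (Qgrp m N) (Qgens m N)) \<le> real ((m + 2) * ord N m)"
    by (rule of_nat_mono)
  then show "real (cay_diam (Qgrp m N) (Qgens m N)) \<le> real (m + 2) * real (ord N m)"
    by (simp only: of_nat_mult)
qed simp

end
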